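(* Let $n\ge1$ and let $v$ be a nontrivial non-Archimedean valuation on a field $\mathbb F$. Then no line $L$ of $\mathrm{PG}(n-1,\mathbb F)$ intersects a colour class of $c_v$ in exactly one point.
   Context: A non-Archimedean valuation on $\mathbb F$ is a function $v:\mathbb F\to\mathbb R\cup\{\infty\}$ with $v^{-1}(\infty)=\{0\}$, $v(ab)=v(a)+v(b)$ and $v(a+b)\ge\min(v(a),v(b))$ for all $a,b$; it is nontrivial if $v(a)\ne0$ for some $a\ne0$. $\mathrm{PG}(n-1,\mathbb F)$ has as points the one-dimensional subspaces $[u]$ of $\mathbb F^n$ ($u\ne0$); a line is the set of points in a two-dimensional subspace. The colouring $c_v$ assigns to $[u]$, $u=(u_1,\dots,u_n)$, the smallest index $s$ with $v(u_s)=\min_iv(u_i)$ (independent of the representative $u$); a colour class is the set of points with a given colour. *)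

theory Defs
  imports "HOL-Analysis.Cartesian_Space" "HOL-Library.Extended_Real"
begin

text \<open>
  The values lie in the reals together with infinity, so \<^term>\<open>-\<infinity> :: ereal\<close> is excluded.
\<close>

definition nonarch_valuation :: "('f::field \<Rightarrow> ereal) \<Rightarrow> bool" where
  "nonarch_valuation v \<longleftrightarrow>
     (\<forall>a. v a \<noteq> -\<infinity>) \<and>
     v -` {\<infinity>} = {0} \<and>
     (\<forall>a b. v (a * b) = v a + v b) \<and>
     (\<forall>a b. v (a + b) \<ge> min (v a) (v b))"

definition nontrivial_valuation :: "('f::field \<Rightarrow> ereal) \<Rightarrow> bool" where
  "nontrivial_valuation v \<longleftrightarrow> (\<exists>a. a \<noteq> 0 \<and> v a \<noteq> 0)"

text \<open>
  PG(n - 1, F) is built on \<^typ>\<open>'f ^ 'n\<close>, where \<^typ>\<open>'n\<close> is a finite linearly ordered type playing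
  the role of the index set 1 < ... < n, so that n = CARD('n) is at least 1.  A point is a
  one-dimensional subspace, and a line is a set of points.
\<close>

definition pg_points :: "('f::field ^ 'n::finite) set set" where
  "pg_points = {P. vec.subspace P \<and> vec.dim P = 1}"

definition pg_line :: "('f::field ^ 'n::finite) set set \<Rightarrow> bool" where
  "pg_line L \<longleftrightarrow>
     (\<exists>W. vec.subspace W \<and> vec.dim W = 2 \<and> L = {P \<in> pg_points. P \<subseteq> W})"

definition vec_colour :: "('f::field \<Rightarrow> ereal) \<Rightarrow> 'f ^ 'n::{finite,linorder} \<Rightarrow> 'n" where
  "vec_colour v u = (LEAST s. v (u $ s) = Min (range (\<lambda>i. v (u $ i))))"

text \<open>
  The common colour of all representatives of a point; it exists by \<open>point_colour_span\<close> below.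
\<close>

definition point_colour ::
    "('f::field \<Rightarrow> ereal) \<Rightarrow> ('f ^ 'n::{finite,linorder}) set \<Rightarrow> 'n" where
  "point_colour v P = (THE s. \<forall>u\<in>P. u \<noteq> 0 \<longrightarrow> vec_colour v u = s)"

definition colour_class ::
    "('f::field \<Rightarrow> ereal) \<Rightarrow> 'n \<Rightarrow> ('f ^ 'n::{finite,linorder}) set set" where
  "colour_class v s = {P \<in> pg_points. point_colour v P = s}"

lemma pg_points_eq_span: "pg_points = {vec.span {u} | u :: 'f::field ^ 'n::finite. u \<noteq> 0}"
proof (intro set_eqI iffI)
  fix P :: "('f ^ 'n) set"
  assume "P \<in> pg_points"
  then have P: "vec.subspace P" "vec.dim P = 1" by (auto simp: pg_points_def)
  obtain B where B: "B \<subseteq> P" "vec.independent B" "P \<subseteq> vec.span B" "card B = vec.dim P"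
    using vec.basis_exists by blast
  obtain u where u: "B = {u}" using B(4) P(2) by (metis card_1_singletonE)
  have "P = vec.span {u}"
    using B(1,3) P(1) u vec.span_minimal[of B P] by auto
  moreover have "u \<noteq> 0" using B(2) u by simp
  ultimately show "P \<in> {vec.span {u} | u. u \<noteq> 0}" by blast
next
  fix P :: "('f ^ 'n) set"
  assume "P \<in> {vec.span {u} | u. u \<noteq> 0}"
  then obtain u where "P = vec.span {u}" "u \<noteq> 0" by blast
  then show "P \<in> pg_points"
    using vec.dim_span_eq_card_independent[of "{u}"]
    by (simp add: pg_points_def)
qed

lemma vec_colour_scale:
  fixes u :: "'f::field ^ 'n::{finite,linorder}"
  assumes "nonarch_valuation v" "k \<noteq> 0"
  shows "vec_colour v (k *s u) = vec_colour v u"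
proof -
  have "v k \<noteq> \<infinity>" "v k \<noteq> -\<infinity>"
    using assms unfolding nonarch_valuation_def by auto
  then obtain r where r: "v k = ereal r" by (cases "v k") auto
  have mult: "v (k * a) = ereal r + v a" for a
    using assms(1) r by (simp add: nonarch_valuation_def)
  have "mono (\<lambda>x. ereal r + x)" by (intro monoI add_left_mono)
  then have "ereal r + Min (range (\<lambda>i. v (u $ i))) = Min ((\<lambda>x. ereal r + x) ` range (\<lambda>i. v (u $ i)))"
    by (intro mono_Min_commute) auto
  then have "Min (range (\<lambda>i. ereal r + v (u $ i))) = ereal r + Min (range (\<lambda>i. v (u $ i)))"
    by (simp add: image_image)
  then show ?thesis
    by (simp add: vec_colour_def mult ereal_add_cancel_left)
qed

lemma point_colour_span:
  fixes u :: "'f::field ^ 'n::{finite,linorder}"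
  assumes "nonarch_valuation v" "u \<noteq> 0"
  shows "point_colour v (vec.span {u}) = vec_colour v u"
  unfolding point_colour_def
proof (rule the_equality)
  show "\<forall>w\<in>vec.span {u}. w \<noteq> 0 \<longrightarrow> vec_colour v w = vec_colour v u"
    using vec_colour_scale[OF assms(1)] by (auto simp: vec.span_singleton)
next
  fix s
  assume "\<forall>w\<in>vec.span {u}. w \<noteq> 0 \<longrightarrow> vec_colour v w = s"
  then show "s = vec_colour v u"
    using assms(2) by (auto simp: vec.span_base)
qed

end

(* If [u] on the line has colour s, subtract a multiple of u from a second vector of the plane to
   get w independent of u with w_s = 0.  For t of large enough valuation, u + t w has the same
   s-th coordinate as u and every coordinate of t w has valuation above v(u_s), so [u + t w] is
   another point of colour s on the line. *)
theory Submission imports Defs begin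

text \<open>Turns \<open>LEAST\<close> and \<open>Min\<close> into inequalities between coordinates,
  the form in which colours are read off and checked later. The indices attaining the minimum form a
  finite nonempty set \<open>A\<close>, and the colour is \<open>Min A\<close>.\<close>

lemma vec_colour_eq_iff:
  fixes u :: "'f::field ^ 'n::{finite,linorder}"
  shows "vec_colour v u = s \<longleftrightarrow>
    (\<forall>i. v (u $ s) \<le> v (u $ i)) \<and> (\<forall>i<s. v (u $ s) < v (u $ i))"
proof -
  define m where "m = Min (range (\<lambda>i. v (u $ i)))"
  define A where "A = {i. v (u $ i) = m}"
  have m_in: "m \<in> range (\<lambda>i. v (u $ i))"
    unfolding m_def by (intro Min_in) auto
  have m_le: "m \<le> v (u $ i)" for i
    unfolding m_def by (intro Min_le) auto
  have "A \<noteq> {}" using m_in by (auto simp: A_def)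
  then have "vec_colour v u = Min A"
    unfolding vec_colour_def m_def[symmetric] A_def by (subst Least_Min) auto
  then have "vec_colour v u = s \<longleftrightarrow> s \<in> A \<and> (\<forall>i\<in>A. s \<le> i)"
    using \<open>A \<noteq> {}\<close> by (auto simp: Min_eq_iff)
  also have "\<dots> \<longleftrightarrow> (\<forall>i. v (u $ s) \<le> v (u $ i)) \<and> (\<forall>i<s. v (u $ s) < v (u $ i))"
  proof (intro iffI conjI)
    assume *: "(\<forall>i. v (u $ s) \<le> v (u $ i)) \<and> (\<forall>i<s. v (u $ s) < v (u $ i))"
    \<comment> \<open>The inequalities do not mention \<open>m\<close>; comparing \<open>s\<close>
      with an index \<open>j\<close> that attains \<open>m\<close> forces
      \<open>v (u $ s) = m\<close>.\<close>
    obtain j where "v (u $ j) = m" using m_in by auto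
    with * m_le[of s] have "v (u $ s) = m" by (metis order.antisym)
    with * show "s \<in> A" "\<forall>i\<in>A. s \<le> i" by (auto simp: A_def not_less[symmetric])
  next
    assume *: "s \<in> A \<and> (\<forall>i\<in>A. s \<le> i)"
    then show "\<forall>i. v (u $ s) \<le> v (u $ i)" using m_le by (auto simp: A_def)
    show "\<forall>i<s. v (u $ s) < v (u $ i)"
      using * m_le by (force simp: A_def order_less_le)
  qed
  finally show ?thesis .
qed

lemma nonarch_valuation_infinity_iff:
  "nonarch_valuation v \<Longrightarrow> v a = \<infinity> \<longleftrightarrow> a = 0"
  by (auto simp: nonarch_valuation_def)

lemma nonarch_valuation_real:
  assumes "nonarch_valuation v" "a \<noteq> 0"
  obtains r where "v a = ereal r"
  using assms by (cases "v a") (auto simp: nonarch_valuation_def)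

lemma nonarch_valuation_one:
  assumes "nonarch_valuation v"
  shows "v 1 = 0"
proof -
  \<comment> \<open>Finiteness matters here: \<infinity> also solves x = x + x, whereas for a real
    value the equation leaves only 0.\<close>
  obtain r where r: "v 1 = ereal r"
    using nonarch_valuation_real[OF assms, of 1] by auto
  have "v (1 * 1) = v 1 + v 1"
    using assms unfolding nonarch_valuation_def by blast
  then show ?thesis using r by (simp add: zero_ereal_def)
qed

text \<open>Since \<open>v a + v (inverse a) = 0\<close> with \<open>v a\<close> nonzero, one of
  \<open>a\<close> and \<open>inverse a\<close> has positive valuation \<open>r\<close>. Its powers
  have valuations \<open>k * r\<close>, which exceed any real bound.\<close>

lemma nontrivial_valuation_unbounded:
  assumes "nonarch_valuation v" "nontrivial_valuation v"
  obtains t where "t \<noteq> 0" "v t > ereal B"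
proof -
  have mult: "v (a * b) = v a + v b" for a b
    using assms(1) by (simp add: nonarch_valuation_def)
  obtain a where a: "a \<noteq> 0" "v a \<noteq> 0"
    using assms(2) by (auto simp: nontrivial_valuation_def)
  have "v a + v (inverse a) = 0"
    using mult[of a "inverse a"] a(1) nonarch_valuation_one[OF assms(1)] by simp
  moreover obtain p where p: "v a = ereal p"
    using nonarch_valuation_real[OF assms(1) a(1)] .
  moreover obtain q where q: "v (inverse a) = ereal q"
    using nonarch_valuation_real[OF assms(1), of "inverse a"] a(1) by auto
  ultimately have "p + q = 0" "p \<noteq> 0"
    using a(2) by (auto simp: zero_ereal_def)
  then have "p > 0 \<or> q > 0" by linarith
  then obtain b r where b: "b \<noteq> 0" "v b = ereal r" "r > 0"
    using a(1) p q by (metis inverse_nonzero_iff_nonzero)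
  have pow: "v (b ^ k) = ereal (real k * r)" for k
    by (induction k)
      (auto simp: nonarch_valuation_one[OF assms(1)] mult b(2) algebra_simps zero_ereal_def)
  obtain k where "B < real k * r"
    using reals_Archimedean3[OF b(3)] by blast
  with b(1) show ?thesis by (intro that[of "b ^ k"]) (auto simp: pow)
qed

theorem theorem12p2:
  fixes v :: "'f::field \<Rightarrow> ereal"
    and L :: "('f ^ 'n::{finite,linorder}) set set"
    and s :: 'n
  assumes "nonarch_valuation v"
    and "nontrivial_valuation v"
    and "pg_line L"
  shows "\<not> (\<exists>!P. P \<in> L \<inter> colour_class v s)"
proof
  assume "\<exists>!P. P \<in> L \<inter> colour_class v s"
  then obtain P where P: "P \<in> L" "P \<in> colour_class v s"
    and unique: "\<And>Q. Q \<in> L \<Longrightarrow> Q \<in> colour_class v s \<Longrightarrow> Q = P"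
    by auto
  have add: "v (a + b) \<ge> min (v a) (v b)" and mult: "v (a * b) = v a + v b" for a b
    using assms(1) by (auto simp: nonarch_valuation_def)
  obtain W where W: "vec.subspace W" "vec.dim W = 2" "L = {P \<in> pg_points. P \<subseteq> W}"
    using assms(3) by (auto simp: pg_line_def)
  obtain u where u: "P = vec.span {u}" "u \<noteq> 0"
    using P(1) W(3) by (auto simp: pg_points_eq_span)
  have "u \<in> W" using P(1) W(3) u(1) vec.span_base[of u "{u}"] by auto
  have "vec_colour v u = s"
    using P(2) u point_colour_span[OF assms(1) u(2)] by (simp add: colour_class_def)
  then have u_min: "v (u $ s) \<le> v (u $ i)" and u_less: "i < s \<Longrightarrow> v (u $ s) < v (u $ i)" for i
    by (auto simp: vec_colour_eq_iff)
  \<comment> \<open>If this coordinate vanished, the minimum of the valuations would be \<infinity>,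
    so every coordinate of \<open>u\<close> would vanish.\<close>
  have us: "u $ s \<noteq> 0"
  proof
    assume "u $ s = 0"
    then have "v (u $ i) = \<infinity>" for i
      using u_min[of i] nonarch_valuation_infinity_iff[OF assms(1), of 0] by simp
    then show False
      using u(2) nonarch_valuation_infinity_iff[OF assms(1)] by (auto simp: vec_eq_iff)
  qed
  \<comment> \<open>The dimensions 1 and 2 differ, so the plane \<open>W\<close> contains a vector
    outside \<open>P\<close>.\<close>
  have "vec.dim P = 1" using P(2) by (simp add: colour_class_def pg_points_def)
  then have "P \<noteq> W" using W(2) by auto
  then obtain w' where w': "w' \<in> W" "w' \<notin> vec.span {u}"
    using P(1) W(3) u(1) by auto
  define w where "w = w' - (w' $ s / u $ s) *s u"
  have "w \<in> W"
    unfolding w_def by (intro vec.subspace_diff vec.subspace_scale W(1) w'(1) \<open>u \<in> W\<close>)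
  have ws: "w $ s = 0" using us by (simp add: w_def)
  have w_notin: "w \<notin> vec.span {u}"
  proof
    assume "w \<in> vec.span {u}"
    then have "w + (w' $ s / u $ s) *s u \<in> vec.span {u}"
      by (simp add: vec.span_add vec.span_scale vec.span_base)
    then show False using w'(2) by (simp add: w_def)
  qed
  obtain c where c: "v (u $ s) = ereal c"
    using nonarch_valuation_real[OF assms(1) us] .
  \<comment> \<open>\<open>v t > B\<close> gives \<open>v t + v (w $ i) > c\<close> wherever
    \<open>w $ i\<close> is nonzero. A zero coordinate has
    \<open>real_of_ereal \<infinity> = 0\<close> and merely adds the harmless entry
    \<open>c\<close>; there \<open>v (t * w $ i)\<close> is \<infinity> anyway.\<close>
  define B where "B = Max (range (\<lambda>i. c - real_of_ereal (v (w $ i))))"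
  obtain t where t: "t \<noteq> 0" "v t > ereal B"
    using nontrivial_valuation_unbounded[OF assms(1,2)] .
  have tw: "v (t * w $ i) > v (u $ s)" for i
  proof (cases "w $ i = 0")
    case True
    then show ?thesis
      using c nonarch_valuation_infinity_iff[OF assms(1), of 0] by simp
  next
    case False
    obtain r where r: "v (w $ i) = ereal r"
      using nonarch_valuation_real[OF assms(1) False] .
    obtain q where q: "v t = ereal q"
      using nonarch_valuation_real[OF assms(1) t(1)] .
    have "c - real_of_ereal (v (w $ i)) \<le> B"
      unfolding B_def by (intro Max_ge) auto
    then show ?thesis using t(2) by (simp add: mult c r q)
  qed
  define x where "x = u + t *s w"
  have xs: "x $ s = u $ s" by (simp add: x_def ws)
  have "vec_colour v x = s"
    unfolding vec_colour_eq_iff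
  proof (intro conjI allI impI)
    fix i
    \<comment> \<open>The ultrametric inequality transfers the bounds from \<open>u\<close> to
      \<open>x\<close>. As \<open>tw\<close> is strict for every \<open>i\<close>, strictness below
      \<open>s\<close> survives, so ties are still broken in favour of \<open>s\<close>.\<close>
    have le: "min (v (u $ i)) (v (t * w $ i)) \<le> v (x $ i)" using add by (simp add: x_def)
    show "v (x $ s) \<le> v (x $ i)"
      using le u_min[of i] tw[of i] unfolding xs by (auto simp: min_def split: if_splits)
    assume "i < s"
    then have "v (u $ s) < min (v (u $ i)) (v (t * w $ i))" using u_less tw by simp
    then show "v (x $ s) < v (x $ i)" using le unfolding xs by (rule less_le_trans)
  qed
  have "x \<noteq> 0" using xs us by auto
  have "x \<in> W"
    unfolding x_def by (intro vec.subspace_add vec.subspace_scale W(1) \<open>u \<in> W\<close> \<open>w \<in> W\<close>)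
  have point: "vec.span {x} \<in> pg_points" using \<open>x \<noteq> 0\<close> by (auto simp: pg_points_eq_span)
  have "vec.span {x} \<subseteq> W" using \<open>x \<in> W\<close> W(1) by (intro vec.span_minimal) auto
  then have "vec.span {x} = P"
    using point W(3) point_colour_span[OF assms(1) \<open>x \<noteq> 0\<close>] \<open>vec_colour v x = s\<close>
    by (intro unique) (auto simp: colour_class_def)
  then have "x \<in> vec.span {u}" using u(1) vec.span_base[of x "{x}"] by auto
  \<comment> \<open>The difference \<open>x - u\<close> is \<open>t *s w\<close>; dividing by the
    nonzero \<open>t\<close> would put \<open>w\<close> into the span of \<open>u\<close>.\<close>
  then have "x - u \<in> vec.span {u}" by (simp add: vec.span_diff vec.span_base)
  then have "inverse t *s (x - u) \<in> vec.span {u}" by (rule vec.span_scale)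
  then show False using w_notin t(1) by (simp add: x_def)
qed

end
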